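(* Let $(L,\cdot,\alpha)$ be a (left) Hom-Leibniz algebra over a field $\mathbb{K}$ of characteristic $0$, put $[x,y] := x\cdot y - y\cdot x$, and let $$J_\alpha(x,y,z) := [[x,y],\alpha(z)] + [[y,z],\alpha(x)] + [[z,x],\alpha(y)].$$ Then for all $x,y,z\in L$, $$J_\alpha(x,y,z) = (x\cdot y)\cdot\alpha(z) + (y\cdot z)\cdot\alpha(x) + (z\cdot x)\cdot\alpha(y).$$
   Context: A Hom-algebra is a triple $(A,\cdot,\alpha)$ where $A$ is a $\mathbb{K}$-vector space, $\cdot$ is a bilinear binary operation on $A$, and $\alpha: A\to A$ is a linear map that is multiplicative: $\alpha(x\cdot y)=\alpha(x)\cdot\alpha(y)$ for all $x,y\in A$. A (left) Hom-Leibniz algebra is a Hom-algebra $(A,\cdot,\alpha)$ such that $\alpha(x)\cdot(y\cdot z) = (x\cdot y)\cdot\alpha(z) + \alpha(y)\cdot(x\cdot z)$ for all $x,y,z\in A$. *)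

theory Defs
  imports Complex_Main
begin

text \<open>
  The underlying vector space is the whole type \<open>'a\<close>, with a scalar multiplication
  \<open>scale\<close> over a field \<open>'k\<close>. \<open>Vector_Spaces.linear\<close> is linearity over an arbitrary
  field (plain \<open>linear\<close> is the real-scalar version) and includes that
  \<open>scale\<close> makes \<open>'a\<close> a vector space.
\<close>

locale hom_algebra = vector_space scale
  for scale :: "'k::field \<Rightarrow> 'a::ab_group_add \<Rightarrow> 'a" +
  fixes mult :: "'a \<Rightarrow> 'a \<Rightarrow> 'a"
    and \<alpha> :: "'a \<Rightarrow> 'a"
  assumes mult_linear_left: "Vector_Spaces.linear scale scale (\<lambda>x. mult x y)"
    and mult_linear_right: "Vector_Spaces.linear scale scale (\<lambda>y. mult x y)"
    and alpha_linear: "Vector_Spaces.linear scale scale \<alpha>"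
    and alpha_mult: "\<alpha> (mult x y) = mult (\<alpha> x) (\<alpha> y)"

locale left_hom_leibniz_algebra = hom_algebra scale mult \<alpha>
  for scale :: "'k::field \<Rightarrow> 'a::ab_group_add \<Rightarrow> 'a"
    and mult :: "'a \<Rightarrow> 'a \<Rightarrow> 'a"
    and \<alpha> :: "'a \<Rightarrow> 'a" +
  assumes left_hom_leibniz:
    "mult (\<alpha> x) (mult y z) = mult (mult x y) (\<alpha> z) + mult (\<alpha> y) (mult x z)"

definition commutator :: "('a::ab_group_add \<Rightarrow> 'a \<Rightarrow> 'a) \<Rightarrow> 'a \<Rightarrow> 'a \<Rightarrow> 'a"
  where "commutator mult x y = mult x y - mult y x"

definition hom_jacobian ::
  "('a::ab_group_add \<Rightarrow> 'a \<Rightarrow> 'a) \<Rightarrow> ('a \<Rightarrow> 'a) \<Rightarrow> 'a \<Rightarrow> 'a \<Rightarrow> 'a \<Rightarrow> 'a"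
  where "hom_jacobian mult \<alpha> x y z =
    commutator mult (commutator mult x y) (\<alpha> z)
    + commutator mult (commutator mult y z) (\<alpha> x)
    + commutator mult (commutator mult z x) (\<alpha> y)"

end

theory Submission
  imports Defs
begin

text \<open>
  The Leibniz identity reads \<open>(x y) \<alpha>(z) = \<alpha>(x) (y z) - \<alpha>(y) (x z)\<close>, which is skew in \<open>x, y\<close>.
  Let \<open>S\<close> be the cyclic sum of these elements. The terms \<open>[x, y] \<alpha>(z)\<close> then add up to \<open>2 S\<close>
  and the terms \<open>\<alpha>(z) [x, y]\<close> to \<open>S\<close>, so the Hom-Jacobian is \<open>S\<close>.
\<close>

context hom_algebra
begin

text \<open>This rule and its mirror image serve to expand products that have a commutator as a
  factor.\<close>

lemma mult_diff_left: "mult (x - y) z = mult x z - mult y z"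
  using module_hom.diff[OF mult_linear_left[unfolded linear_iff_module_hom]] .

lemma mult_diff_right: "mult x (y - z) = mult x y - mult x z"
  using module_hom.diff[OF mult_linear_right[unfolded linear_iff_module_hom]] .

end

theorem proposition3p3:
  fixes scale :: "'k::field_char_0 \<Rightarrow> 'a::ab_group_add \<Rightarrow> 'a"
    and mult :: "'a \<Rightarrow> 'a \<Rightarrow> 'a"
    and \<alpha> :: "'a \<Rightarrow> 'a"
    and x y z :: 'a
  assumes "left_hom_leibniz_algebra scale mult \<alpha>"
  shows "hom_jacobian mult \<alpha> x y z =
    mult (mult x y) (\<alpha> z) + mult (mult y z) (\<alpha> x) + mult (mult z x) (\<alpha> y)"
proof -
  interpret left_hom_leibniz_algebra scale mult \<alpha> by fact
  \<comment> \<open>Solved for the left-nested product, the identity is a rewrite rule that trades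
    it for right-nested ones.\<close>
  have "mult (mult u v) (\<alpha> w) = mult (\<alpha> u) (mult v w) - mult (\<alpha> v) (mult u w)" for u v w
    using left_hom_leibniz[of u v w] by simp
  then show ?thesis
    \<comment> \<open>Both sides become integer combinations of the six products \<alpha>(a) (b c),
      with a, b, c a permutation of x, y, z, and agree in the additive group.\<close>
    by (simp add: hom_jacobian_def commutator_def mult_diff_left mult_diff_right)
qed

end
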